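(* Let $(X,d)$ be a complete metric space and let $\sigma\colon X\times X\times[0,1]\to X$ be a conical geodesic bicombing that has the midpoint property. Suppose that $\phi\colon X\to X$ is a $\sigma$-equivariant isometry of $(X,d)$. If there is a point $x_0\in X$ and a compact subset $K\subset X$ such that $$\limsup_{k\to+\infty}\left(\sup_{l\ge0}\frac1k\sum_{i=0}^{k-1}\mathbf 1_K(\phi^{i+l}(x_0))\right)>0,$$ then there is a point $x_\star\in\overline{\mathrm{conv}_\sigma}\big(\{\phi^k(x_0):k\ge0\}\big)$ such that $\phi(x_\star)=x_\star$.
   Context: Let $(X,d)$ be a metric space. An isometry of $(X,d)$ is an element of the isometry group of $X$, i.e. a distance-preserving bijection $X\to X$. In the supremum, $l$ ranges over the non-negative integers, and $\mathbf 1_K\colon X\to\{0,1\}$ is the indicator function of $K$. A map $\sigma\colon X\times X\times[0,1]\to X$, written $\sigma_{xy}(t):=\sigma(x,y,t)$, is a conical geodesic bicombing if for all $x,y\in X$ the map $\sigma_{xy}$ is a constant speed geodesic from $x$ to $y$, that is, $\sigma_{xy}(0)=x$, $\sigma_{xy}(1)=y$ and $d(\sigma_{xy}(s),\sigma_{xy}(t))=|s-t|\,d(x,y)$ for all $s,t\in[0,1]$, and if $d(\sigma_{xy}(t),\sigma_{x'y'}(t))\le(1-t)d(x,x')+t\,d(y,y')$ for all $x,x',y,y'\in X$ and $t\in[0,1]$. It has the midpoint property if $\sigma_{xy}(\tfrac12)=\sigma_{yx}(\tfrac12)$ for all $x,y\in X$. For $A\subset X$, put $A_1:=A$, $A_{k+1}:=\{\sigma_{xy}(t):x,y\in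 A_k,\ t\in[0,1]\}$. The $\sigma$-convex hull of $A$ is $\mathrm{conv}_\sigma(A):=\bigcup_{k\ge1}A_k$, and $\overline{\mathrm{conv}_\sigma}(A)$ denotes its closure. An isometry $\phi\colon X\to X$ is $\sigma$-equivariant if $\phi\circ\sigma_{xy}=\sigma_{\phi(x)\phi(y)}$ for all $x,y\in X$. *)

theory Defs
  imports "HOL-Analysis.Analysis"
begin

(* A map X x X x [0,1] -> X is represented by a function with a third argument of type real.
   Only its values at parameters in {0..1} are ever used; values outside are arbitrary. *)

definition conical_geodesic_bicombing :: "('a::metric_space \<Rightarrow> 'a \<Rightarrow> real \<Rightarrow> 'a) \<Rightarrow> bool" where
  "conical_geodesic_bicombing \<sigma> \<longleftrightarrow>
     (\<forall>x y. \<sigma> x y 0 = x \<and> \<sigma> x y 1 = y \<and>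
        (\<forall>s\<in>{0..1}. \<forall>t\<in>{0..1}. dist (\<sigma> x y s) (\<sigma> x y t) = \<bar>s - t\<bar> * dist x y)) \<and>
     (\<forall>x y x' y'. \<forall>t\<in>{0..1}.
        dist (\<sigma> x y t) (\<sigma> x' y' t) \<le> (1 - t) * dist x x' + t * dist y y')"

definition midpoint_property :: "('a \<Rightarrow> 'a \<Rightarrow> real \<Rightarrow> 'a) \<Rightarrow> bool" where
  "midpoint_property \<sigma> \<longleftrightarrow> (\<forall>x y. \<sigma> x y (1/2) = \<sigma> y x (1/2))"

(* Indexed from 0: bicombing_stage \<sigma> A k is the set usually written A_(k+1), with A_1 = A. *)
primrec bicombing_stage :: "('a \<Rightarrow> 'a \<Rightarrow> real \<Rightarrow> 'a) \<Rightarrow> 'a set \<Rightarrow> nat \<Rightarrow> 'a set" where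
  "bicombing_stage \<sigma> A 0 = A"
| "bicombing_stage \<sigma> A (Suc k) =
     {\<sigma> x y t | x y t. x \<in> bicombing_stage \<sigma> A k \<and> y \<in> bicombing_stage \<sigma> A k \<and> t \<in> {0..1}}"

definition bicombing_hull :: "('a \<Rightarrow> 'a \<Rightarrow> real \<Rightarrow> 'a) \<Rightarrow> 'a set \<Rightarrow> 'a set" where
  "bicombing_hull \<sigma> A = (\<Union>k. bicombing_stage \<sigma> A k)"

definition metric_isometry :: "('a::metric_space \<Rightarrow> 'a) \<Rightarrow> bool" where
  "metric_isometry \<phi> \<longleftrightarrow> bij \<phi> \<and> (\<forall>x y. dist (\<phi> x) (\<phi> y) = dist x y)"

definition bicombing_equivariant :: "('a \<Rightarrow> 'a \<Rightarrow> real \<Rightarrow> 'a) \<Rightarrow> ('a \<Rightarrow> 'a) \<Rightarrow> bool" where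
  "bicombing_equivariant \<sigma> \<phi> \<longleftrightarrow>
     (\<forall>x y. \<forall>t\<in>{0..1}. \<phi> (\<sigma> x y t) = \<sigma> (\<phi> x) (\<phi> y) t)"

end

theory Submission
  imports Defs
begin

text \<open>
  The fixed point is the limit of the iterated midpoints \<open>y 0 = x0\<close>,
  \<open>y (Suc n) = m (y n) (\<phi> (y n))\<close>, where \<open>m\<close> is the midpoint map of the bicombing.
  Two independent facts make this sequence converge to a fixed point.

  The first is that \<open>D n j = dist (y n) (\<phi>\<^sup>j (y n))\<close> tends to \<open>0\<close> as \<open>n \<rightarrow> \<infinity>\<close>, for each \<open>j\<close>,
  as soon as the orbit of \<open>x0\<close> is bounded.  Since \<open>m\<close> is symmetric, the midpoint of
  \<open>y n\<close> and \<open>\<phi> (y n)\<close> can be compared crosswise with that of \<open>\<phi>\<^sup>j (y n)\<close> and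
  \<open>\<phi>\<^sup>j\<^sup>+\<^sup>1 (y n)\<close>, which gives \<open>D (n+1) j \<le> (D n (j-1) + D n (j+1)) / 2\<close> for \<open>j \<ge> 1\<close>.
  Comparing them straight shows that \<open>D n j\<close> decreases in \<open>n\<close>.  The limit in \<open>n\<close> is thus a bounded
  convex function of \<open>j\<close> that vanishes at \<open>0\<close>, and so it is \<open>0\<close>.

  The second is that the orbit of \<open>x0\<close> is totally bounded.  If it contained arbitrarily
  many points \<open>\<phi>\<^sup>a x0\<close>, \<open>a \<in> P\<close>, at pairwise distance at least \<open>e\<close>, then for any ball of radius
  \<open>e/2\<close> the translates by \<open>a \<in> P\<close> of the set of visiting times would be disjoint, so the visiting times
  would have upper Banach density at most \<open>1 / card P\<close>.  As finitely many such balls cover \<open>K\<close>, this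
  contradicts the positive density of the visits to \<open>K\<close>.

  Total boundedness says that, up to \<open>e\<close>, every iterate of \<open>\<phi>\<close> acts on \<open>x0\<close> as one of
  finitely many, and convexity of the metric passes this on to every \<open>y n\<close>.  Therefore the convergence
  \<open>D n j \<rightarrow> 0\<close> is uniform in \<open>j\<close>.  The balls being convex, all later \<open>y k\<close> stay within
  \<open>sup\<^sub>j D n j\<close> of \<open>y n\<close>; the sequence is Cauchy, and its limit is fixed because \<open>D n 1 \<rightarrow> 0\<close>.
\<close>

section \<open>Visits of positive density and total boundedness of the orbit\<close>

lemma dist_funpow_isometry:
  fixes \<phi> :: "'a::metric_space \<Rightarrow> 'a"
  assumes "\<And>x y. dist (\<phi> x) (\<phi> y) = dist x y"
  shows "dist ((\<phi> ^^ n) x) ((\<phi> ^^ n) y) = dist x y"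
  by (induction n) (auto simp: assms)

lemma dist_funpow_add:
  fixes \<phi> :: "'a::metric_space \<Rightarrow> 'a"
  assumes "\<And>x y. dist (\<phi> x) (\<phi> y) = dist x y"
  shows "dist ((\<phi> ^^ (n + i)) x) ((\<phi> ^^ (n + j)) y) = dist ((\<phi> ^^ i) x) ((\<phi> ^^ j) y)"
  using dist_funpow_isometry[OF assms] by (simp add: funpow_add)

lemma exists_separated_times:
  assumes "e > 0" and far: "\<And>L. \<exists>m. \<forall>j\<le>L. e \<le> dist (u m) (u j)"
  shows "\<exists>P::nat set. finite P \<and> card P = p \<and> (\<forall>a\<in>P. \<forall>b\<in>P. a \<noteq> b \<longrightarrow> e \<le> dist (u a) (u b))"
proof (induction p)
  case 0
  show ?case by (rule exI[of _ "{}"]) auto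
next
  case (Suc p)
  then obtain P where P: "finite P" "card P = p"
    "\<forall>a\<in>P. \<forall>b\<in>P. a \<noteq> b \<longrightarrow> e \<le> dist (u a) (u b)" by blast
  obtain m where m: "\<forall>j\<le>Max (insert 0 P). e \<le> dist (u m) (u j)"
    using far by blast
  have far_P: "e \<le> dist (u m) (u j)" if "j \<in> P" for j
    using m that P(1) by simp
  then have "m \<notin> P" using \<open>e > 0\<close> by fastforce
  with P far_P show ?case
    by (intro exI[of _ "insert m P"]) (auto simp: dist_commute)
qed

text \<open>
  Visits at times \<open>s\<close> and \<open>s'\<close> to a ball of radius \<open>e/2\<close> satisfy
  \<open>dist (\<phi>\<^sup>s x) (\<phi>\<^sup>s\<^sup>' x) < e\<close>, and such a distance depends on \<open>s - s'\<close> only.  So an \<open>e\<close>-separated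
  set \<open>P\<close> of times moves the visiting times to disjoint sets, all of them contained in a window that is
  longer by a constant.
\<close>
lemma card_ball_visits:
  fixes \<phi> :: "'a::metric_space \<Rightarrow> 'a"
  assumes iso: "\<And>x y. dist (\<phi> x) (\<phi> y) = dist x y"
    and P: "finite P" "\<And>a b. a \<in> P \<Longrightarrow> b \<in> P \<Longrightarrow> a \<noteq> b \<Longrightarrow> e \<le> dist ((\<phi> ^^ a) x) ((\<phi> ^^ b) x)"
    and M: "\<And>a. a \<in> P \<Longrightarrow> a \<le> M"
  shows "card P * card {i. i < k \<and> (\<phi> ^^ (i + l)) x \<in> ball c (e/2)} \<le> k + M"
proof -
  let ?S = "{i. i < k \<and> (\<phi> ^^ (i + l)) x \<in> ball c (e/2)}"
  have "inj_on (\<lambda>(a, s). a + s) (P \<times> ?S)"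
  proof (rule inj_onI, clarify)
    fix a s b t
    assume a: "a \<in> P" and b: "b \<in> P" and eq: "a + s = b + t"
      and s: "(\<phi> ^^ (s + l)) x \<in> ball c (e/2)" and t: "(\<phi> ^^ (t + l)) x \<in> ball c (e/2)"
    have "dist ((\<phi> ^^ (s + l)) x) ((\<phi> ^^ (t + l)) x) < e"
      using dist_triangle_half_r[of c _ e] s t by (auto simp: mem_ball)
    moreover have "dist ((\<phi> ^^ a) x) ((\<phi> ^^ b) x) = dist ((\<phi> ^^ (t + l)) x) ((\<phi> ^^ (s + l)) x)"
    proof -
      have "dist ((\<phi> ^^ a) x) ((\<phi> ^^ b) x)
          = dist ((\<phi> ^^ ((t + l + s) + a)) x) ((\<phi> ^^ ((t + l + s) + b)) x)"
        by (simp only: dist_funpow_add[OF iso])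
      also have "(t + l + s) + a = (a + s) + (t + l)" by simp
      also have "(t + l + s) + b = (a + s) + (s + l)" using eq by simp
      finally show ?thesis by (simp only: dist_funpow_add[OF iso])
    qed
    ultimately have "a = b" using P(2)[OF a b] by (auto simp: dist_commute)
    with eq show "a = b \<and> s = t" by simp
  qed
  moreover have "(\<lambda>(a, s). a + s) ` (P \<times> ?S) \<subseteq> {..<k + M}"
    using M by (fastforce)
  ultimately have "card (P \<times> ?S) \<le> card {..<k + M}"
    using card_inj_on_le by blast
  then show ?thesis by (simp add: card_cartesian_product)
qed

lemma orbit_totally_bounded:
  fixes \<phi> :: "'a::metric_space \<Rightarrow> 'a"
  assumes iso: "\<And>x y. dist (\<phi> x) (\<phi> y) = dist x y"
    and K: "compact K" and c: "c > 0" and e: "e > 0"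
    and dens: "\<exists>\<^sub>F k in sequentially. \<exists>l. c * real k < real (card {i. i < k \<and> (\<phi> ^^ (i + l)) x \<in> K})"
  shows "\<exists>L. \<forall>m. \<exists>j\<le>L. dist ((\<phi> ^^ m) x) ((\<phi> ^^ j) x) < e"
proof (rule ccontr)
  assume "\<not> ?thesis"
  then have sep: "\<And>L. \<exists>m. \<forall>j\<le>L. e \<le> dist ((\<phi> ^^ m) x) ((\<phi> ^^ j) x)"
    by (meson not_less)
  obtain C where C: "finite C" "K \<subseteq> (\<Union>z\<in>C. ball z (e/2))"
  proof (rule compactE_image[OF K])
    show "open (ball z (e/2))" if "z \<in> K" for z by simp
    show "K \<subseteq> (\<Union>z\<in>K. ball z (e/2))" using e by force
  qed blast
  \<comment> \<open>Some ball around a point of \<open>C\<close> is visited with density at least \<open>c / card C\<close>, whereas \<open>p\<close> separated times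
    allow at most \<open>1 / p\<close>.\<close>
  obtain p where p: "real (card C) < real p * c"
    using reals_Archimedean3[OF c] by blast
  obtain P where P: "finite P" "card P = p"
    "\<forall>a\<in>P. \<forall>b\<in>P. a \<noteq> b \<longrightarrow> e \<le> dist ((\<phi> ^^ a) x) ((\<phi> ^^ b) x)"
    using exists_separated_times[OF e sep] by blast
  define M where "M = Max (insert 0 P)"
  have M: "a \<le> M" if "a \<in> P" for a using that P(1) by (simp add: M_def)
  have bound: "p * card {i. i < k \<and> (\<phi> ^^ (i + l)) x \<in> K} \<le> card C * (k + M)" for k l
  proof -
    let ?S = "\<lambda>z. {i. i < k \<and> (\<phi> ^^ (i + l)) x \<in> ball z (e/2)}"
    have "card {i. i < k \<and> (\<phi> ^^ (i + l)) x \<in> K} \<le> card (\<Union>z\<in>C. ?S z)"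
    proof (rule card_mono)
      show "finite (\<Union>z\<in>C. ?S z)" using C(1) by simp
      show "{i. i < k \<and> (\<phi> ^^ (i + l)) x \<in> K} \<subseteq> (\<Union>z\<in>C. ?S z)" using C(2) by blast
    qed
    also have "\<dots> \<le> (\<Sum>z\<in>C. card (?S z))"
      using C(1) by (rule card_UN_le)
    finally have "p * card {i. i < k \<and> (\<phi> ^^ (i + l)) x \<in> K} \<le> (\<Sum>z\<in>C. p * card (?S z))"
      by (simp add: sum_distrib_left[symmetric])
    also have "\<dots> \<le> (\<Sum>z\<in>C. k + M)"
    proof (rule sum_mono)
      fix z
      show "p * card (?S z) \<le> k + M"
        using card_ball_visits[OF iso P(1) _ M, where e = e and x = x and k = k and l = l and c = z] P(2,3)
        by simp
    qed
    finally show ?thesis by simp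
  qed
  \<comment> \<open>For large \<open>k\<close> the excess length \<open>M\<close> of the windows is absorbed by the gap between
    \<open>p * c\<close> and \<open>card C\<close>.\<close>
  have "\<forall>\<^sub>F k in sequentially. real (card C) * real M \<le> (real p * c - real (card C)) * real k"
  proof -
    obtain N where N: "real (card C) * real M < real N * (real p * c - real (card C))"
      using reals_Archimedean3 p by (metis diff_gt_0_iff_gt)
    have "real (card C) * real M \<le> (real p * c - real (card C)) * real k" if "k \<ge> N" for k
    proof -
      have "(real p * c - real (card C)) * real N \<le> (real p * c - real (card C)) * real k"
        using that p by (intro mult_left_mono) auto
      with N show ?thesis by (simp add: mult.commute)
    qed
    then show ?thesis using eventually_sequentially by blast
  qed
  from frequently_eventually_conj[OF dens this] obtain k l
    where k: "c * real k < real (card {i. i < k \<and> (\<phi> ^^ (i + l)) x \<in> K})"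
      "real (card C) * real M \<le> (real p * c - real (card C)) * real k"
    by (auto dest!: frequently_ex)
  have "p > 0" using p by (cases p) auto
  have "real p * (c * real k) < real p * real (card {i. i < k \<and> (\<phi> ^^ (i + l)) x \<in> K})"
    using k(1) \<open>p > 0\<close> by simp
  also have "\<dots> \<le> real (card C) * (real k + real M)"
    using of_nat_mono[OF bound[of k l], where 'a = real] by (simp only: of_nat_mult of_nat_add)
  finally show False using k(2) by (simp add: algebra_simps)
qed

section \<open>Iterated midpoints\<close>

text \<open>
  This is what a conical bicombing looks like at the parameter \<open>1/2\<close>: conicality becomes midpoint
  convexity of the metric, the constancy of \<open>\<sigma> x x\<close> becomes idempotence, and an equivariant isometry
  becomes an isometric homomorphism of \<open>m\<close>.
\<close>
locale midpoint_isometry =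
  fixes m :: "'a::metric_space \<Rightarrow> 'a \<Rightarrow> 'a" and \<phi> :: "'a \<Rightarrow> 'a"
  assumes mid_commute: "m x y = m y x"
    and mid_same: "m x x = x"
    and dist_mid_le: "dist (m x y) (m x' y') \<le> (dist x x' + dist y y') / 2"
    and iso: "dist (\<phi> x) (\<phi> y) = dist x y"
    and equivariant: "\<phi> (m x y) = m (\<phi> x) (\<phi> y)"
begin

primrec iter_mid :: "'a \<Rightarrow> nat \<Rightarrow> 'a" where
  "iter_mid x 0 = x"
| "iter_mid x (Suc n) = m (iter_mid x n) (\<phi> (iter_mid x n))"

lemma funpow_mid: "(\<phi> ^^ k) (m x y) = m ((\<phi> ^^ k) x) ((\<phi> ^^ k) y)"
  by (induction k) (auto simp: equivariant)

lemma funpow_iter_mid_Suc: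
  "(\<phi> ^^ k) (iter_mid x (Suc n)) = m ((\<phi> ^^ k) (iter_mid x n)) ((\<phi> ^^ Suc k) (iter_mid x n))"
  by (simp add: funpow_mid funpow_swap1)

lemma dist_funpow_iter_mid_Suc_le:
  "dist ((\<phi> ^^ i) (iter_mid x (Suc n))) ((\<phi> ^^ j) (iter_mid x (Suc n)))
     \<le> dist ((\<phi> ^^ i) (iter_mid x n)) ((\<phi> ^^ j) (iter_mid x n))"
  unfolding funpow_iter_mid_Suc
  by (rule order_trans[OF dist_mid_le]) (simp add: iso)

lemma dist_funpow_iter_mid_le:
  "dist ((\<phi> ^^ i) (iter_mid x n)) ((\<phi> ^^ j) (iter_mid x n)) \<le> dist ((\<phi> ^^ i) x) ((\<phi> ^^ j) x)"
proof (induction n)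
  case (Suc n)
  then show ?case using dist_funpow_iter_mid_Suc_le[of i x n j] by linarith
qed simp

text \<open>
  The symmetry of the midpoint enters here: pairing \<open>\<phi> y\<close> with \<open>\<phi>\<^sup>j y\<close> and \<open>y\<close> with
  \<open>\<phi>\<^sup>j\<^sup>+\<^sup>1 y\<close> replaces the lag \<open>j\<close> by the average over the lags \<open>j - 1\<close> and \<open>j + 1\<close>.
\<close>
lemma dist_iter_mid_Suc_average:
  "dist (iter_mid x (Suc n)) ((\<phi> ^^ Suc j) (iter_mid x (Suc n)))
     \<le> (dist (iter_mid x n) ((\<phi> ^^ j) (iter_mid x n))
        + dist (iter_mid x n) ((\<phi> ^^ Suc (Suc j)) (iter_mid x n))) / 2"
proof -
  let ?y = "iter_mid x n"
  have "dist (iter_mid x (Suc n)) ((\<phi> ^^ Suc j) (iter_mid x (Suc n)))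
      = dist (m (\<phi> ?y) ?y) (m ((\<phi> ^^ Suc j) ?y) ((\<phi> ^^ Suc (Suc j)) ?y))"
    unfolding funpow_iter_mid_Suc by (simp add: mid_commute)
  also have "\<dots> \<le> (dist (\<phi> ?y) ((\<phi> ^^ Suc j) ?y) + dist ?y ((\<phi> ^^ Suc (Suc j)) ?y)) / 2"
    by (rule dist_mid_le)
  finally show ?thesis by (simp add: iso)
qed

end

text \<open>
  A bounded convex sequence on the natural numbers cannot increase, because an increment that is once
  positive stays bounded below by the same positive number.
\<close>
lemma bounded_convex_seq_le_start:
  fixes E :: "nat \<Rightarrow> real"
  assumes convex: "\<And>j. E (Suc j) \<le> (E j + E (Suc (Suc j))) / 2"
    and bound: "\<And>j. E j \<le> B"
  shows "E j \<le> E 0"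
proof -
  have "E (Suc j) \<le> E j" for j
  proof (rule ccontr)
    assume "\<not> ?thesis"
    then have pos: "E (Suc j) - E j > 0" by simp
    have incr: "E (Suc j) - E j \<le> E (Suc (j + i)) - E (j + i)" for i
    proof (induction i)
      case (Suc i)
      then show ?case using convex[of "j + i"] by simp
    qed simp
    have lin: "E j + real i * (E (Suc j) - E j) \<le> E (j + i)" for i
    proof (induction i)
      case (Suc i)
      then show ?case using incr[of i] by (simp add: algebra_simps)
    qed simp
    obtain i where "B - E j < real i * (E (Suc j) - E j)"
      using reals_Archimedean3[OF pos] by blast
    with lin[of i] bound[of "j + i"] show False by linarith
  qed
  then have "decseq E" by (simp add: decseq_Suc_iff)
  then show ?thesis by (simp add: decseq_def)
qed

context midpoint_isometry
begin

lemma dist_iter_mid_tendsto_0: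
  assumes bound: "\<And>j. dist x ((\<phi> ^^ j) x) \<le> B"
  shows "(\<lambda>n. dist (iter_mid x n) ((\<phi> ^^ j) (iter_mid x n))) \<longlonglongrightarrow> 0"
proof -
  define D where "D n j = dist (iter_mid x n) ((\<phi> ^^ j) (iter_mid x n))" for n j
  have "decseq (\<lambda>n. D n j)" for j
    unfolding D_def decseq_Suc_iff using dist_funpow_iter_mid_Suc_le[of 0 x _ j] by simp
  moreover have "bdd_below (range (\<lambda>n. D n j))" for j
    by (rule bdd_belowI[of _ 0]) (auto simp: D_def)
  ultimately have lim: "(\<lambda>n. D n j) \<longlonglongrightarrow> (INF n. D n j)" for j
    by (intro LIMSEQ_decseq_INF)
  define E where "E j = (INF n. D n j)" for j
  have lim: "(\<lambda>n. D n j) \<longlonglongrightarrow> E j" for j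
    using lim by (simp add: E_def)
  have "E (Suc j) \<le> (E j + E (Suc (Suc j))) / 2" for j
  proof (rule LIMSEQ_le)
    show "(\<lambda>n. D (Suc n) (Suc j)) \<longlonglongrightarrow> E (Suc j)"
      by (rule LIMSEQ_Suc[OF lim])
    show "(\<lambda>n. (D n j + D n (Suc (Suc j))) / 2) \<longlonglongrightarrow> (E j + E (Suc (Suc j))) / 2"
      by (intro tendsto_intros lim) simp
    show "\<exists>N. \<forall>n\<ge>N. D (Suc n) (Suc j) \<le> (D n j + D n (Suc (Suc j))) / 2"
      unfolding D_def using dist_iter_mid_Suc_average by blast
  qed
  moreover have "E j \<le> B" for j
  proof (rule LIMSEQ_le_const2[OF lim])
    have "D n j \<le> B" for n
      unfolding D_def using dist_funpow_iter_mid_le[of 0 x n j] bound[of j] by simp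
    then show "\<exists>N. \<forall>n\<ge>N. D n j \<le> B" by blast
  qed
  ultimately have "E j \<le> E 0" by (rule bounded_convex_seq_le_start)
  moreover have "E 0 = 0" by (simp add: E_def D_def)
  moreover have "0 \<le> E j" by (rule LIMSEQ_le_const[OF lim]) (auto simp: D_def)
  ultimately show ?thesis using lim[of j] by (simp add: D_def)
qed

text \<open>
  Total boundedness gives an \<open>L\<close> such that every \<open>\<phi>\<^sup>k x\<close> is within \<open>e/2\<close> of some \<open>\<phi>\<^sup>j x\<close>,
  \<open>j \<le> L\<close>.  Taking iterated midpoints does not increase these distances, so the same \<open>L\<close> serves every
  \<open>n\<close>, and convergence at the finitely many lags \<open>j \<le> L\<close> is uniform.
\<close>
lemma orbit_iter_mid_small:
  assumes tb: "\<And>e. e > 0 \<Longrightarrow> \<exists>L. \<forall>k. \<exists>j\<le>L. dist ((\<phi> ^^ k) x) ((\<phi> ^^ j) x) < e"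
    and e: "e > 0"
  shows "\<forall>\<^sub>F n in sequentially. \<forall>k. dist (iter_mid x n) ((\<phi> ^^ k) (iter_mid x n)) < e"
proof -
  have "\<exists>B. \<forall>k. dist x ((\<phi> ^^ k) x) \<le> B"
  proof -
    obtain L where L: "\<And>k. \<exists>j\<le>L. dist ((\<phi> ^^ k) x) ((\<phi> ^^ j) x) < 1"
      using tb[of 1] by auto
    have "dist x ((\<phi> ^^ k) x) \<le> (\<Sum>j\<le>L. dist x ((\<phi> ^^ j) x)) + 1" for k
    proof -
      obtain j where j: "j \<le> L" "dist ((\<phi> ^^ k) x) ((\<phi> ^^ j) x) < 1" using L by blast
      have "dist x ((\<phi> ^^ j) x) \<le> (\<Sum>j\<le>L. dist x ((\<phi> ^^ j) x))"
        using j(1) by (intro member_le_sum) auto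
      with j(2) show ?thesis
        using dist_triangle2[of x "(\<phi> ^^ k) x" "(\<phi> ^^ j) x"] by linarith
    qed
    then show ?thesis by blast
  qed
  then obtain B where B: "\<And>k. dist x ((\<phi> ^^ k) x) \<le> B" by blast
  obtain L where L: "\<And>k. \<exists>j\<le>L. dist ((\<phi> ^^ k) x) ((\<phi> ^^ j) x) < e/2"
    using tb[of "e/2"] e by auto
  have "\<forall>\<^sub>F n in sequentially. \<forall>j\<in>{..L}. dist (iter_mid x n) ((\<phi> ^^ j) (iter_mid x n)) < e/2"
    using order_tendstoD(2)[OF dist_iter_mid_tendsto_0[OF B], of "e/2"] e
    by (intro eventually_ball_finite) auto
  then show ?thesis
  proof (rule eventually_mono, intro allI)
    fix n k
    assume small: "\<forall>j\<in>{..L}. dist (iter_mid x n) ((\<phi> ^^ j) (iter_mid x n)) < e/2"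
    obtain j where j: "j \<le> L" "dist ((\<phi> ^^ k) x) ((\<phi> ^^ j) x) < e/2" using L by blast
    have "dist ((\<phi> ^^ k) (iter_mid x n)) ((\<phi> ^^ j) (iter_mid x n)) < e/2"
      using dist_funpow_iter_mid_le[of k x n j] j(2) by linarith
    moreover have "dist (iter_mid x n) ((\<phi> ^^ j) (iter_mid x n)) < e/2"
      using small j(1) by simp
    ultimately show "dist (iter_mid x n) ((\<phi> ^^ k) (iter_mid x n)) < e"
      by (metis dist_commute dist_triangle_half_l)
  qed
qed

text \<open>
  A closed ball contains the midpoint of any two of its points, so it contains all later orbits of
  iterated midpoints along with the present one.
\<close>
lemma later_iter_mid_in_cball:
  assumes "\<And>k. dist z ((\<phi> ^^ k) (iter_mid x n)) \<le> r"
  shows "dist z ((\<phi> ^^ k) (iter_mid x (n + i))) \<le> r"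
proof (induction i arbitrary: k)
  case (Suc i)
  let ?y = "iter_mid x (n + i)"
  have "dist z ((\<phi> ^^ k) (iter_mid x (n + Suc i)))
      = dist (m z z) (m ((\<phi> ^^ k) ?y) ((\<phi> ^^ Suc k) ?y))"
    using funpow_iter_mid_Suc[of k x "n + i"] by (simp add: mid_same)
  also have "\<dots> \<le> (dist z ((\<phi> ^^ k) ?y) + dist z ((\<phi> ^^ Suc k) ?y)) / 2"
    by (rule dist_mid_le)
  also have "\<dots> \<le> r"
    using add_mono[OF Suc[of k] Suc[of "Suc k"]] by simp
  finally show ?case .
qed (use assms in simp)

lemma Cauchy_iter_mid:
  assumes "\<And>e. e > 0 \<Longrightarrow> \<exists>L. \<forall>k. \<exists>j\<le>L. dist ((\<phi> ^^ k) x) ((\<phi> ^^ j) x) < e"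
  shows "Cauchy (iter_mid x)"
proof (rule metric_CauchyI)
  fix e :: real
  assume "e > 0"
  then obtain n where n: "\<And>k. dist (iter_mid x n) ((\<phi> ^^ k) (iter_mid x n)) < e/3"
    using orbit_iter_mid_small[OF assms, of "e/3"] by (auto simp: eventually_sequentially)
  have close: "dist (iter_mid x n) (iter_mid x p) \<le> e/3" if "p \<ge> n" for p
    using later_iter_mid_in_cball[of "iter_mid x n" x n "e/3" 0 "p - n"] n that
    by (simp add: less_imp_le)
  show "\<exists>M. \<forall>p\<ge>M. \<forall>q\<ge>M. dist (iter_mid x p) (iter_mid x q) < e"
  proof (intro exI allI impI)
    fix p q
    assume "n \<le> p" "n \<le> q"
    then show "dist (iter_mid x p) (iter_mid x q) < e"
      using close[of p] close[of q] \<open>e > 0\<close>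
        dist_triangle3[of "iter_mid x p" "iter_mid x q" "iter_mid x n"] by linarith
  qed
qed

lemma limit_iter_mid_fixed:
  assumes tb: "\<And>e. e > 0 \<Longrightarrow> \<exists>L. \<forall>k. \<exists>j\<le>L. dist ((\<phi> ^^ k) x) ((\<phi> ^^ j) x) < e"
    and lim: "iter_mid x \<longlonglongrightarrow> z"
  shows "\<phi> z = z"
proof -
  have "continuous_on UNIV \<phi>"
    unfolding continuous_on_iff using iso by metis
  then have "(\<lambda>n. \<phi> (iter_mid x n)) \<longlonglongrightarrow> \<phi> z"
    by (rule continuous_on_tendsto_compose[OF _ lim]) auto
  then have "(\<lambda>n. dist (iter_mid x n) (\<phi> (iter_mid x n))) \<longlonglongrightarrow> dist z (\<phi> z)"
    by (intro tendsto_dist lim)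
  moreover have "\<forall>\<^sub>F n in sequentially. dist (iter_mid x n) (\<phi> (iter_mid x n)) \<le> e" if "e > 0" for e
    using orbit_iter_mid_small[OF tb that]
    by (rule eventually_mono) (auto dest!: spec[of _ 1] simp: less_imp_le)
  ultimately have "dist z (\<phi> z) \<le> e" if "e > 0" for e
    using that by (intro tendsto_upperbound) auto
  then have "dist z (\<phi> z) \<le> 0" by (rule dense_ge)
  then show ?thesis by simp
qed

end

section \<open>Midpoints of a conical bicombing\<close>

lemma midpoint_isometry_bicombing:
  assumes "conical_geodesic_bicombing \<sigma>" "midpoint_property \<sigma>"
    and "metric_isometry \<phi>" "bicombing_equivariant \<sigma> \<phi>"
  shows "midpoint_isometry (\<lambda>x y. \<sigma> x y (1/2)) \<phi>"
proof
  fix x y x' y'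
  show "\<sigma> x y (1/2) = \<sigma> y x (1/2)"
    using assms(2) by (simp add: midpoint_property_def)
  have geodesic: "\<sigma> x x 0 = x" "dist (\<sigma> x x s) (\<sigma> x x t) = \<bar>s - t\<bar> * dist x x"
    if "s \<in> {0..1}" "t \<in> {0..1}" for s t
    using assms(1) that unfolding conical_geodesic_bicombing_def by blast+
  show "\<sigma> x x (1/2) = x"
    using geodesic[of 0 "1/2"] by simp
  have "dist (\<sigma> x y t) (\<sigma> x' y' t) \<le> (1 - t) * dist x x' + t * dist y y'"
    if "t \<in> {0..1}" for t
    using assms(1) that unfolding conical_geodesic_bicombing_def by blast
  from this[of "1/2"]
  show "dist (\<sigma> x y (1/2)) (\<sigma> x' y' (1/2)) \<le> (dist x x' + dist y y') / 2"
    by (simp add: field_simps)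
  show "dist (\<phi> x) (\<phi> y) = dist x y"
    using assms(3) by (simp add: metric_isometry_def)
  show "\<phi> (\<sigma> x y (1/2)) = \<sigma> (\<phi> x) (\<phi> y) (1/2)"
    using assms(4) by (simp add: bicombing_equivariant_def)
qed

lemma frequent_visits_of_limsup_pos:
  fixes u :: "nat \<Rightarrow> 'a"
  assumes "limsup (\<lambda>k. SUP l. ereal (1 / real k * (\<Sum>i<k. indicator K (u (i + l))))) > 0"
  obtains c where "c > 0"
    "\<exists>\<^sub>F k in sequentially. \<exists>l. c * real k < real (card {i. i < k \<and> u (i + l) \<in> K})"
proof -
  obtain c where c: "0 < ereal c"
    "ereal c < limsup (\<lambda>k. SUP l. ereal (1 / real k * (\<Sum>i<k. indicator K (u (i + l)))))"
    using ereal_dense2[OF assms] by blast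
  have visits: "(\<Sum>i<k. indicator K (u (i + l))) = real (card {i. i < k \<and> u (i + l) \<in> K})" for k l
  proof -
    have "(\<Sum>i<k. indicator K (u (i + l))) = (\<Sum>i<k. if u (i + l) \<in> K then 1 else (0::real))"
      by (intro sum.cong) (auto simp: indicator_def)
    also have "\<dots> = real (card ({..<k} \<inter> {i. u (i + l) \<in> K}))"
      by (simp add: sum.If_cases)
    also have "{..<k} \<inter> {i. u (i + l) \<in> K} = {i. i < k \<and> u (i + l) \<in> K}" by auto
    finally show ?thesis .
  qed
  have "\<exists>\<^sub>F k in sequentially. ereal c < (SUP l. ereal (1 / real k * (\<Sum>i<k. indicator K (u (i + l)))))"
    (is "\<exists>\<^sub>F k in _. _ < ?f k")
  proof (rule ccontr)
    assume "\<not> ?thesis"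
    then have "\<forall>\<^sub>F k in sequentially. ?f k \<le> ereal c"
      by (simp add: not_frequently not_less)
    then have "limsup ?f \<le> ereal c" by (rule Limsup_bounded)
    with c(2) show False by simp
  qed
  then have "\<exists>\<^sub>F k in sequentially. \<exists>l. c * real k < real (card {i. i < k \<and> u (i + l) \<in> K})"
  proof (rule frequently_elim1)
    fix k
    assume "ereal c < ?f k"
    then obtain l where "c < real (card {i. i < k \<and> u (i + l) \<in> K}) / real k"
      unfolding less_SUP_iff visits by auto
    \<comment> \<open>At \<open>k = 0\<close> the quotient is \<open>0\<close> by convention, which the positive \<open>c\<close> excludes.\<close>
    moreover from this have "k > 0" using c(1) by (cases k) auto
    ultimately show "\<exists>l. c * real k < real (card {i. i < k \<and> u (i + l) \<in> K})"
      by (auto simp: pos_less_divide_eq)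
  qed
  with c(1) show thesis by (intro that) auto
qed

theorem theorem1p2:
  fixes \<sigma> :: "'a::complete_space \<Rightarrow> 'a \<Rightarrow> real \<Rightarrow> 'a"
    and \<phi> :: "'a \<Rightarrow> 'a"
    and x0 :: 'a
    and K :: "'a set"
  assumes "conical_geodesic_bicombing \<sigma>"
    and "midpoint_property \<sigma>"
    and "metric_isometry \<phi>"
    and "bicombing_equivariant \<sigma> \<phi>"
    and "compact K"
    and "limsup (\<lambda>k::nat. SUP l::nat.
           ereal (1 / real k * (\<Sum>i<k. indicator K ((\<phi> ^^ (i + l)) x0)))) > 0"
  shows "\<exists>x\<in>closure (bicombing_hull \<sigma> {(\<phi> ^^ k) x0 | k::nat. True}). \<phi> x = x"
proof -
  let ?A = "{(\<phi> ^^ k) x0 | k::nat. True}"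
  interpret midpoint_isometry "\<lambda>x y. \<sigma> x y (1/2)" \<phi>
    using assms(1-4) by (rule midpoint_isometry_bicombing)
  obtain c where c: "c > 0"
    "\<exists>\<^sub>F k in sequentially. \<exists>l. c * real k < real (card {i. i < k \<and> (\<phi> ^^ (i + l)) x0 \<in> K})"
    using assms(6) by (rule frequent_visits_of_limsup_pos)
  have tb: "\<exists>L. \<forall>k. \<exists>j\<le>L. dist ((\<phi> ^^ k) x0) ((\<phi> ^^ j) x0) < e" if "e > 0" for e
    using iso assms(5) c(1) that c(2) by (rule orbit_totally_bounded)
  obtain z where z: "iter_mid x0 \<longlonglongrightarrow> z"
    using Cauchy_iter_mid[OF tb] by (auto simp: Cauchy_convergent_iff convergent_def)
  \<comment> \<open>The next stage needs \<open>\<phi> (y n)\<close> as well, so the whole orbit of \<open>y n\<close> is carried along.\<close>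
  have "(\<phi> ^^ k) (iter_mid x0 n) \<in> bicombing_stage \<sigma> ?A n" for k n
  proof (induction n arbitrary: k)
    case (Suc n)
    show ?case
      unfolding funpow_iter_mid_Suc bicombing_stage.simps
      by (intro CollectI exI conjI) (rule refl Suc | simp)+
  qed auto
  from this[of 0] have "iter_mid x0 n \<in> bicombing_hull \<sigma> ?A" for n
    by (auto simp: bicombing_hull_def)
  with z have "z \<in> closure (bicombing_hull \<sigma> ?A)"
    by (auto simp: closure_sequential)
  moreover have "\<phi> z = z"
    using tb z by (rule limit_iter_mid_fixed)
  ultimately show ?thesis by blast
qed

end
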